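(* Let $\varepsilon>0$ and let $\mathcal{M}$ be the randomized algorithm described in the context (functional mechanism in vertically partitioned multiparty learning), which takes a dataset $D$ and returns $\bar{\mathbf{w}}$. Then $\mathcal{M}$ satisfies $\varepsilon$-differential privacy with respect to the whole dataset $D$: for all neighboring datasets $D,D'$ (datasets with the same number $n$ of records that differ in exactly one record) and all measurable subsets $Z$ of the range of $\mathcal{M}$, $$\Pr(\mathcal{M}(D)\in Z)\le \exp(\varepsilon)\cdot\Pr(\mathcal{M}(D')\in Z).$$
   Context: Data. A dataset $D=(t_1,\dots,t_n)$ consists of $n$ records $t_i=(\mathbf{x}_i,y_i)$ from a fixed record domain $\mathcal{T}$, with $\mathbf{x}_i\in[-1,1]^d$ and label $y_i$ in a fixed bounded set ($[-1,1]$ for linear regression, $\{0,1\}$ for logistic regression). The $d$ features are partitioned into $K$ disjoint blocks. Party $P_k$ ($1\le k\le K$) holds the part $D^k$ of the dataset consisting of the $k$-th block of features of all records. Party $P_1$ additionally holds the labels. Objective. For $\mathbf{w}=(w_1,\dots,w_d)\in\mathbb{R}^d$ and $j\in\mathbb{N}$, let $\mathbf{\Phi}_j=\{w_1^{c_1}\cdots w_d^{c_d} : c_l\in\mathbb{N},\ \sum_l c_l=j\}$ be the set of monomials of degree $j$. The objective function is a polynomial of degree at most $J$ in $\mathbf{w}$: $$f_D(\mathbf{w})=\sum_{i=1}^n\sum_{j=0}^J\sum_{\phi\in\mathbf{\Phi}_j}\lambda_{\phi t_i}\,\phi(\mathbf{w}),$$ where for each monomial $\phi$ the coefficient $\lambda_{\phi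 t}\in\mathbb{R}$ is a fixed function of the record $t\in\mathcal{T}$. Write $\lambda_\phi=\sum_{i=1}^n\lambda_{\phi t_i}$. Each coefficient $\lambda_\phi$ is either single-party (computable from the data $D^k$ of one party $P_k$) or cross-party (it involves the data of at least two parties). Noise scale. Let $\Delta_f=2\max_{t\in\mathcal{T}}\sum_{j=1}^J\sum_{\phi\in\mathbf{\Phi}_j}|\lambda_{\phi t}|$, assumed finite and positive. $Lap(\sigma)$ denotes the Laplace distribution with mean $0$ and scale $\sigma$, i.e. with density $\frac{1}{2\sigma}\exp(-|x|/\sigma)$. Algorithm $\mathcal{M}$. Single-party coefficients are computed by the party concerned. Cross-party coefficients are computed exactly by the parties concerned through secure vector multiplication, which reveals nothing else. The parties then form, for every monomial $\phi$ of degree at most $J$, the noisy coefficient $\bar\lambda_\phi=\lambda_\phi+\eta_\phi$, where the $\eta_\phi$ are independent with distribution $Lap(\Delta_f/\varepsilon)$, and send these to the server. The server forms $\bar f_D(\mathbf{w})=\sum_{j=0}^J\sum_{\phi\in\mathbf{\Phi}_j}\bar\lambda_\phi\,\phi(\mathbf{w})$ and returns $\bar{\mathbf{w}}=\arg\min_{\mathbf{w}}\bar f_D(\mathbf{w})$. Here $\arg\min$ is a fixed measurable rule assigning an output to each polynomial. Since adding a constant to a function does not change its minimizers, the rule depends only on the coefficients of the monomials of degree $j\ge 1$. *)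

theory Defs
  imports "HOL-Probability.Probability"
begin

section \<open>Records, datasets and vertical partitioning\<close>

type_synonym 'd datum = "(real ^ 'd) \<times> real"

definition datasets :: "'d datum set \<Rightarrow> nat \<Rightarrow> 'd datum list set" where
  "datasets T n = {D. length D = n \<and> set D \<subseteq> T}"

definition neighbouring :: "'d datum list \<Rightarrow> 'd datum list \<Rightarrow> bool" where
  "neighbouring D D' \<longleftrightarrow> length D = length D' \<and> (\<exists>!i. i < length D \<and> D ! i \<noteq> D' ! i)"

definition feature_blocks :: "nat \<Rightarrow> (nat \<Rightarrow> 'd set) \<Rightarrow> bool" where
  "feature_blocks K B \<longleftrightarrow> disjoint_family_on B {1..K} \<and> (\<Union>k\<in>{1..K}. B k) = UNIV"

text \<open>The part of a dataset held by one party: for every record the features of the block of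
  that party, and the label if the party is number 1.\<close>

type_synonym 'd part = "(('d \<Rightarrow> real) \<times> real option) list"

definition party_data :: "(nat \<Rightarrow> 'd set) \<Rightarrow> nat \<Rightarrow> ('d::finite) datum list \<Rightarrow> 'd part" where
  "party_data B k D =
     map (\<lambda>(x, y). (restrict (\<lambda>l. x $ l) (B k), if k = 1 then Some y else None)) D"

section \<open>Monomials and polynomials\<close>

text \<open>A monomial is represented by its exponent vector.\<close>

type_synonym 'd mon = "'d \<Rightarrow> nat"

definition mon_eval :: "('d::finite) mon \<Rightarrow> real ^ 'd \<Rightarrow> real" where
  "mon_eval c w = (\<Prod>l\<in>UNIV. (w $ l) ^ c l)"

definition Phi :: "nat \<Rightarrow> ('d::finite) mon set" where
  "Phi j = {c. (\<Sum>l\<in>UNIV. c l) = j}"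

definition monomials :: "nat \<Rightarrow> ('d::finite) mon set" where
  "monomials J = (\<Union>j\<le>J. Phi j)"

definition poly_fun :: "nat \<Rightarrow> ('d mon \<Rightarrow> real) \<Rightarrow> real ^ ('d::finite) \<Rightarrow> real" where
  "poly_fun J a w = (\<Sum>j\<le>J. \<Sum>c\<in>Phi j. a c * mon_eval c w)"

definition objective ::
    "nat \<Rightarrow> ('d mon \<Rightarrow> 'd datum \<Rightarrow> real) \<Rightarrow> ('d::finite) datum list \<Rightarrow> real ^ 'd \<Rightarrow> real" where
  "objective J lam D w =
     (\<Sum>i<length D. \<Sum>j\<le>J. \<Sum>c\<in>Phi j. lam c (D ! i) * mon_eval c w)"

definition coeff :: "('d mon \<Rightarrow> 'd datum \<Rightarrow> real) \<Rightarrow> 'd datum list \<Rightarrow> 'd mon \<Rightarrow> real" where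
  "coeff lam D c = (\<Sum>i<length D. lam c (D ! i))"

lemma objective_eq_poly_fun: "objective J lam D = poly_fun J (coeff lam D)"
proof
  fix w
  have "objective J lam D w =
      (\<Sum>j\<le>J. \<Sum>i<length D. \<Sum>c\<in>Phi j. lam c (D ! i) * mon_eval c w)"
    unfolding objective_def by (rule sum.swap)
  also have "\<dots> = (\<Sum>j\<le>J. \<Sum>c\<in>Phi j. \<Sum>i<length D. lam c (D ! i) * mon_eval c w)"
    by (intro sum.cong refl sum.swap)
  finally show "objective J lam D w = poly_fun J (coeff lam D) w"
    by (simp add: poly_fun_def coeff_def sum_distrib_right)
qed

section \<open>Computation of the coefficients by the parties\<close>

definition single_party ::
    "nat \<Rightarrow> (nat \<Rightarrow> 'd set) \<Rightarrow> ('d::finite) datum set \<Rightarrow> nat \<Rightarrow>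
     ('d mon \<Rightarrow> 'd datum \<Rightarrow> real) \<Rightarrow> 'd mon \<Rightarrow> bool" where
  "single_party K B T n lam c \<longleftrightarrow>
     (\<exists>k\<in>{1..K}. \<exists>g. \<forall>D\<in>datasets T n. coeff lam D c = g (party_data B k D))"

text \<open>How one coefficient is obtained: either one party evaluates a function of its own part, or
  a set of parties evaluates a function of their joint parts. The latter is the ideal functionality
  of secure vector multiplication, which delivers the exact value and nothing else.\<close>

datatype 'd computation =
  Local nat "'d part \<Rightarrow> real"
| Secure "nat set" "(nat \<Rightarrow> 'd part) \<Rightarrow> real"

fun computed :: "(nat \<Rightarrow> 'd set) \<Rightarrow> ('d::finite) datum list \<Rightarrow> 'd computation \<Rightarrow> real" where
  "computed B D (Local k g) = g (party_data B k D)"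
| "computed B D (Secure S h) = h (\<lambda>k\<in>S. party_data B k D)"

fun parties_ok ::
    "nat \<Rightarrow> (nat \<Rightarrow> 'd set) \<Rightarrow> ('d::finite) datum set \<Rightarrow> nat \<Rightarrow>
     ('d mon \<Rightarrow> 'd datum \<Rightarrow> real) \<Rightarrow> 'd mon \<Rightarrow> 'd computation \<Rightarrow> bool" where
  "parties_ok K B T n lam c (Local k g) \<longleftrightarrow> k \<in> {1..K}"
| "parties_ok K B T n lam c (Secure S h) \<longleftrightarrow>
     S \<subseteq> {1..K} \<and> 2 \<le> card S \<and> \<not> single_party K B T n lam c"

definition coefficient_protocol ::
    "nat \<Rightarrow> nat \<Rightarrow> (nat \<Rightarrow> 'd set) \<Rightarrow> ('d::finite) datum set \<Rightarrow> nat \<Rightarrow>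
     ('d mon \<Rightarrow> 'd datum \<Rightarrow> real) \<Rightarrow> ('d mon \<Rightarrow> 'd computation) \<Rightarrow> bool" where
  "coefficient_protocol J K B T n lam prot \<longleftrightarrow>
     (\<forall>c\<in>monomials J. parties_ok K B T n lam c (prot c) \<and>
        (\<forall>D\<in>datasets T n. computed B D (prot c) = coeff lam D c))"

section \<open>The functional mechanism\<close>

definition record_norm ::
    "nat \<Rightarrow> ('d mon \<Rightarrow> 'd datum \<Rightarrow> real) \<Rightarrow> ('d::finite) datum \<Rightarrow> real" where
  "record_norm J lam t = (\<Sum>j=1..J. \<Sum>c\<in>Phi j. \<bar>lam c t\<bar>)"

definition noise_bound ::
    "nat \<Rightarrow> ('d mon \<Rightarrow> 'd datum \<Rightarrow> real) \<Rightarrow> ('d::finite) datum set \<Rightarrow> real" where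
  "noise_bound J lam T = 2 * (SUP t\<in>T. record_norm J lam t)"

definition laplace :: "real \<Rightarrow> real measure" where
  "laplace s = density lborel (\<lambda>x. ennreal (1 / (2 * s) * exp (- \<bar>x\<bar> / s)))"

definition noisy_coeffs ::
    "nat \<Rightarrow> (nat \<Rightarrow> 'd set) \<Rightarrow> ('d mon \<Rightarrow> 'd computation) \<Rightarrow> ('d::finite) datum list \<Rightarrow>
     ('d mon \<Rightarrow> real) \<Rightarrow> 'd mon \<Rightarrow> real" where
  "noisy_coeffs J B prot D \<eta> = (\<lambda>c\<in>monomials J. computed B D (prot c) + \<eta> c)"

text \<open>A noisy polynomial may be unbounded below, and minimizers need not be unique. A rule
  therefore returns some minimizer if there is one, and an arbitrary point otherwise. Measurability
  refers to the coefficient vector.\<close>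

definition argmin_rule ::
    "nat \<Rightarrow> ((real ^ ('d::finite) \<Rightarrow> real) \<Rightarrow> real ^ 'd) \<Rightarrow> bool" where
  "argmin_rule J amin \<longleftrightarrow>
     (\<lambda>a. amin (poly_fun J a)) \<in> PiM (monomials J) (\<lambda>_. borel) \<rightarrow>\<^sub>M borel \<and>
     (\<forall>a. (\<exists>w. is_arg_min (poly_fun J a) (\<lambda>_. True) w) \<longrightarrow>
        is_arg_min (poly_fun J a) (\<lambda>_. True) (amin (poly_fun J a))) \<and>
     (\<forall>a b. (\<forall>j\<in>{1..J}. \<forall>c\<in>Phi j. a c = b c) \<longrightarrow>
        amin (poly_fun J a) = amin (poly_fun J b))"

definition functional_mechanism ::
    "nat \<Rightarrow> (nat \<Rightarrow> 'd set) \<Rightarrow> ('d::finite) datum set \<Rightarrow> ('d mon \<Rightarrow> 'd datum \<Rightarrow> real) \<Rightarrow>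
     ('d mon \<Rightarrow> 'd computation) \<Rightarrow> ((real ^ 'd \<Rightarrow> real) \<Rightarrow> real ^ 'd) \<Rightarrow> real \<Rightarrow>
     'd datum list \<Rightarrow> (real ^ 'd) measure" where
  "functional_mechanism J B T lam prot amin \<epsilon> D =
     distr (PiM (monomials J) (\<lambda>_. laplace (noise_bound J lam T / \<epsilon>))) borel
       (\<lambda>\<eta>. amin (poly_fun J (noisy_coeffs J B prot D \<eta>)))"

definition differentially_private ::
    "real \<Rightarrow> 'd datum list set \<Rightarrow> ('d datum list \<Rightarrow> 'o measure) \<Rightarrow> 'o measure \<Rightarrow> bool" where
  "differentially_private \<epsilon> X M R \<longleftrightarrow>
     (\<forall>D\<in>X. \<forall>D'\<in>X. neighbouring D D' \<longrightarrow>
        (\<forall>Z\<in>sets R. measure (M D) Z \<le> exp \<epsilon> * measure (M D') Z))"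

section \<open>The mechanism yields probability measures\<close>

lemma sets_laplace [measurable_cong]: "sets (laplace s) = sets borel"
  by (simp add: laplace_def)

lemma prob_space_laplace:
  assumes "0 < s"
  shows "prob_space (laplace s)"
proof
  let ?e = "\<lambda>x. ennreal (exponential_density (1 / s) x)"
  interpret E: prob_space "density lborel ?e"
    using assms by (intro prob_space_exponential_density) simp
  have e: "(\<integral>\<^sup>+x. ?e x \<partial>lborel) = 1"
    using E.emeasure_space_1 by (simp add: emeasure_density)
  have e': "(\<integral>\<^sup>+x. ?e (- x) \<partial>lborel) = 1"
    using nn_integral_real_affine[of ?e "-1" 0] e by simp
  have "emeasure (laplace s) (space (laplace s)) =
      (\<integral>\<^sup>+x. ennreal (1 / (2 * s) * exp (- \<bar>x\<bar> / s)) \<partial>lborel)"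
    by (simp add: laplace_def emeasure_density)
  also have "\<dots> = (\<integral>\<^sup>+x. ennreal (1/2) * (?e x + ?e (- x)) \<partial>lborel)"
  proof (rule nn_integral_cong_AE)
    have "ennreal (1 / (2 * s) * exp (- \<bar>x\<bar> / s)) = ennreal (1/2) * (?e x + ?e (- x))"
      if "x \<noteq> 0" for x
    proof -
      have nn: "0 \<le> exponential_density (1 / s) y" for y
        using assms by (intro exponential_density_nonneg) simp
      have split: "1 / (2 * s) * exp (- \<bar>x\<bar> / s) =
          1/2 * (exponential_density (1 / s) x + exponential_density (1 / s) (- x))"
        using that assms by (auto simp: exponential_density_def abs_if)
      show ?thesis
        unfolding split ennreal_plus[OF nn[of x] nn[of "- x"], symmetric]
        by (rule ennreal_mult') simp
    qed
    then show "AE x in lborel. ennreal (1 / (2 * s) * exp (- \<bar>x\<bar> / s)) =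
        ennreal (1/2) * (?e x + ?e (- x))"
      by (rule eventually_mono[OF AE_lborel_singleton[of 0]])
  qed
  also have "\<dots> = ennreal (1/2) * (1 + 1)"
    by (simp add: nn_integral_cmult nn_integral_add e e')
  also have "\<dots> = 1"
  proof -
    have "ennreal (1/2) * ennreal 2 = ennreal (1/2 * 2)"
      by (rule ennreal_mult'[symmetric]) simp
    then show ?thesis by simp
  qed
  finally show "emeasure (laplace s) (space (laplace s)) = 1" .
qed

lemma prob_space_functional_mechanism:
  assumes "0 < \<epsilon>" and "0 < noise_bound J lam T" and "argmin_rule J amin"
  shows "prob_space (functional_mechanism J B T lam prot amin \<epsilon> D)"
proof -
  let ?N = "PiM (monomials J) (\<lambda>_. laplace (noise_bound J lam T / \<epsilon>))"
  have N: "prob_space ?N"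
    using assms by (intro prob_space_PiM prob_space_laplace) simp
  have "noisy_coeffs J B prot D \<in> ?N \<rightarrow>\<^sub>M PiM (monomials J) (\<lambda>_. borel)"
    unfolding noisy_coeffs_def[abs_def] by measurable
  moreover have "(\<lambda>a. amin (poly_fun J a)) \<in> PiM (monomials J) (\<lambda>_. borel) \<rightarrow>\<^sub>M borel"
    using assms by (simp add: argmin_rule_def)
  ultimately have "(\<lambda>\<eta>. amin (poly_fun J (noisy_coeffs J B prot D \<eta>))) \<in> ?N \<rightarrow>\<^sub>M borel"
    by (rule measurable_compose)
  then show ?thesis
    unfolding functional_mechanism_def by (rule prob_space.prob_space_distr[OF N])
qed

end

theory Submission
  imports Defs
begin

text \<open>
  Only the coefficients of degree at least 1 influence the output. On these, exchanging one record
  moves the coefficient vector by at most \<open>\<Delta>\<close> in the \<open>\<ell>\<^sub>1\<close> norm. The \<open>\<epsilon>\<close>-differential privacy is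
  inherited from the product Laplace noise of scale \<open>\<Delta> / \<epsilon>\<close>, whose translation by a vector \<open>u\<close>
  changes densities at most by the factor \<open>exp (\<parallel>u\<parallel>\<^sub>1 * \<epsilon> / \<Delta>)\<close>. The constant term, which the bound
  \<open>\<Delta>\<close> does not control, is compared by translating it by 0.
\<close>

text \<open>A change of variable moves the shift from \<open>f\<close> to the density, and the
  triangle inequality bounds the ratio of the shifted to the original density pointwise. Taking a
  nonnegative function \<open>f\<close> instead of an event lets the bound be applied one coordinate
  at a time.\<close>

lemma nn_integral_laplace_translate_le:
  assumes s: "0 < s" and [measurable]: "f \<in> borel_measurable borel"
  shows "(\<integral>\<^sup>+x. f (u + x) \<partial>laplace s) \<le> ennreal (exp (\<bar>u\<bar> / s)) * (\<integral>\<^sup>+x. f x \<partial>laplace s)"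
proof -
  define p where "p x = ennreal (1 / (2 * s) * exp (- \<bar>x\<bar> / s))" for x
  have [measurable]: "p \<in> borel_measurable borel"
    unfolding p_def by measurable
  have int: "(\<integral>\<^sup>+x. g x \<partial>laplace s) = (\<integral>\<^sup>+x. p x * g x \<partial>lborel)"
    if "g \<in> borel_measurable borel" for g
    using that unfolding laplace_def p_def[symmetric] by (simp add: nn_integral_density)
  have p_le: "p (x - u) \<le> ennreal (exp (\<bar>u\<bar> / s)) * p x" for x
  proof -
    have "- \<bar>x - u\<bar> / s \<le> \<bar>u\<bar> / s + - \<bar>x\<bar> / s"
      using s by (simp add: field_simps)
    then have "exp (- \<bar>x - u\<bar> / s) \<le> exp (\<bar>u\<bar> / s) * exp (- \<bar>x\<bar> / s)"
      by (simp add: exp_add[symmetric])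
    then have "1 / (2 * s) * exp (- \<bar>x - u\<bar> / s) \<le>
        exp (\<bar>u\<bar> / s) * (1 / (2 * s) * exp (- \<bar>x\<bar> / s))"
      using s by (simp add: divide_right_mono)
    then show ?thesis
      unfolding p_def by (simp add: ennreal_mult'[symmetric] ennreal_leI)
  qed
  have "(\<integral>\<^sup>+x. f (u + x) \<partial>laplace s) = (\<integral>\<^sup>+x. p x * f (u + x) \<partial>lborel)"
    by (rule int) measurable
  \<comment> \<open>Lebesgue measure is invariant under the substitution of \<open>u + x\<close> for
    \<open>x\<close>.\<close>
  also have "\<dots> = (\<integral>\<^sup>+x. p (x - u) * f x \<partial>lborel)"
    using nn_integral_real_affine[of "\<lambda>x. p (x - u) * f x" 1 u] by simp
  also have "\<dots> \<le> (\<integral>\<^sup>+x. ennreal (exp (\<bar>u\<bar> / s)) * (p x * f x) \<partial>lborel)"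
    unfolding mult.assoc[symmetric] by (intro nn_integral_mono mult_right_mono p_le) simp
  also have "\<dots> = ennreal (exp (\<bar>u\<bar> / s)) * (\<integral>\<^sup>+x. f x \<partial>laplace s)"
    by (simp add: int nn_integral_cmult)
  finally show ?thesis .
qed

text \<open>Induction on the coordinates: Tonelli splits off coordinate \<open>i\<close>, the
  one-dimensional bound handles the inner integral, and the exponential factors multiply to that of
  the l1 norm. \<open>f\<close> is arbitrary because the induction hypothesis is applied to
  \<open>F\<close>, which is \<open>f\<close> with coordinate \<open>i\<close> integrated
  out.\<close>

lemma nn_integral_PiM_laplace_translate_le:
  assumes s: "0 < s" and "finite I" and "f \<in> borel_measurable (PiM I (\<lambda>_. borel))"
  shows "(\<integral>\<^sup>+x. f (\<lambda>i\<in>I. u i + x i) \<partial>PiM I (\<lambda>_. laplace s))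
      \<le> ennreal (exp ((\<Sum>i\<in>I. \<bar>u i\<bar>) / s)) * (\<integral>\<^sup>+x. f x \<partial>PiM I (\<lambda>_. laplace s))"
  using assms(2,3)
proof (induction I arbitrary: f rule: finite_induct)
  case empty
  then show ?case by (simp add: PiM_empty nn_integral_count_space_finite)
next
  case (insert i I)
  interpret prob_space "laplace s"
    by (rule prob_space_laplace[OF s])
  interpret product_sigma_finite "\<lambda>_. laplace s"
    by standard
  note [measurable] = insert.prems
  define e where "e = ennreal (exp (\<bar>u i\<bar> / s))"
  define F where "F z = (\<integral>\<^sup>+y. f (z(i := y)) \<partial>laplace s)" for z
  have [measurable]: "F \<in> borel_measurable (PiM I (\<lambda>_. borel))"
    unfolding F_def by measurable
  \<comment> \<open>Since \<open>i\<close> is not in \<open>I\<close>, the shift acts separately on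
    the new coordinate and on the old ones.\<close>
  have upd: "(\<lambda>k\<in>insert i I. u k + (x(i := y)) k) = (\<lambda>k\<in>I. u k + x k)(i := u i + y)" for x y
    using insert.hyps by (auto simp: fun_eq_iff)
  have le: "(\<integral>\<^sup>+y. f ((\<lambda>k\<in>I. u k + x k)(i := u i + y)) \<partial>laplace s)
      \<le> e * F (\<lambda>k\<in>I. u k + x k)" for x
  proof -
    \<comment> \<open>The section of \<open>f\<close> in coordinate \<open>i\<close> is measurable
      when the fixed part is a point of the product space.\<close>
    have [measurable]: "(\<lambda>k\<in>I. u k + x k) \<in> space (PiM I (\<lambda>_. borel))"
      by (simp add: space_PiM)
    have "(\<lambda>y. f ((\<lambda>k\<in>I. u k + x k)(i := y))) \<in> borel_measurable borel"
      by measurable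
    from nn_integral_laplace_translate_le[OF s this] show ?thesis
      unfolding e_def F_def .
  qed
  have "(\<integral>\<^sup>+x. f (\<lambda>k\<in>insert i I. u k + x k) \<partial>PiM (insert i I) (\<lambda>_. laplace s)) =
      (\<integral>\<^sup>+x. (\<integral>\<^sup>+y. f ((\<lambda>k\<in>I. u k + x k)(i := u i + y)) \<partial>laplace s) \<partial>PiM I (\<lambda>_. laplace s))"
    unfolding upd[symmetric]
    by (intro product_nn_integral_insert insert.hyps) measurable
  also have "\<dots> \<le> (\<integral>\<^sup>+x. e * F (\<lambda>k\<in>I. u k + x k) \<partial>PiM I (\<lambda>_. laplace s))"
    by (intro nn_integral_mono le)
  also have "\<dots> = e * (\<integral>\<^sup>+x. F (\<lambda>k\<in>I. u k + x k) \<partial>PiM I (\<lambda>_. laplace s))"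
    by (rule nn_integral_cmult) measurable
  also have "\<dots> \<le> e * (ennreal (exp ((\<Sum>k\<in>I. \<bar>u k\<bar>) / s)) *
      (\<integral>\<^sup>+x. F x \<partial>PiM I (\<lambda>_. laplace s)))"
    by (intro mult_left_mono insert.IH) auto
  also have "(\<integral>\<^sup>+x. F x \<partial>PiM I (\<lambda>_. laplace s)) =
      (\<integral>\<^sup>+x. f x \<partial>PiM (insert i I) (\<lambda>_. laplace s))"
    unfolding F_def by (intro product_nn_integral_insert[symmetric] insert.hyps) measurable
  also have "e * (ennreal (exp ((\<Sum>k\<in>I. \<bar>u k\<bar>) / s)) * c) =
      ennreal (exp ((\<Sum>k\<in>insert i I. \<bar>u k\<bar>) / s)) * c" for c
    using insert.hyps
    by (simp add: e_def mult.assoc[symmetric] ennreal_mult'[symmetric] exp_add[symmetric]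
        add_divide_distrib)
  finally show ?case .
qed

lemma finite_Phi: "finite (Phi j :: ('d::finite) mon set)"
proof (rule finite_subset)
  show "(Phi j :: 'd mon set) \<subseteq> PiE UNIV (\<lambda>_. {..j})"
    by (auto simp: Phi_def intro: member_le_sum)
qed (intro finite_PiE; simp)

lemma finite_monomials: "finite (monomials J :: ('d::finite) mon set)"
  by (simp add: monomials_def finite_Phi)

lemma sum_monomials: "sum g (monomials J) = (\<Sum>j\<le>J. sum g (Phi j))"
  unfolding monomials_def by (rule sum.UNION_disjoint) (auto simp: finite_Phi, auto simp: Phi_def)

text \<open>All summands except that of the exchanged record cancel. The index \<open>i\<close> is
  the same for all monomials, so the differences can later be summed over \<open>c\<close> for one
  fixed pair of records.\<close>

lemma coeff_diff_neighbouring: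
  assumes "neighbouring D D'"
  obtains i where "i < length D" "i < length D'"
    "\<And>c. coeff lam D c - coeff lam D' c = lam c (D ! i) - lam c (D' ! i)"
proof -
  from assms obtain i where i: "i < length D" "length D = length D'"
    and eq: "\<And>k. k < length D \<Longrightarrow> k \<noteq> i \<Longrightarrow> D ! k = D' ! k"
    unfolding neighbouring_def by metis
  have "coeff lam D c - coeff lam D' c = lam c (D ! i) - lam c (D' ! i)" for c
  proof -
    have "coeff lam D c - coeff lam D' c = (\<Sum>k<length D. lam c (D ! k) - lam c (D' ! k))"
      using i by (simp add: coeff_def sum_subtractf)
    also have "\<dots> = (\<Sum>k\<in>{i}. lam c (D ! k) - lam c (D' ! k))"
      using i eq by (intro sum.mono_neutral_right) auto
    finally show ?thesis by simp
  qed
  with i that show ?thesis by simp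
qed

text \<open>The factor 2 in \<open>noise_bound\<close> pays for the record removed and the record
  inserted, each contributing at most the supremum of \<open>record_norm\<close>. Boundedness makes
  that supremum a genuine upper bound.\<close>

lemma coeff_sensitivity:
  assumes bdd: "bdd_above (record_norm J lam ` T)"
    and D: "D \<in> datasets T n" "D' \<in> datasets T n" and nb: "neighbouring D D'"
  shows "(\<Sum>j=1..J. \<Sum>c\<in>Phi j. \<bar>coeff lam D c - coeff lam D' c\<bar>) \<le> noise_bound J lam T"
proof -
  obtain i where i: "i < length D" "i < length D'"
    and eq: "\<And>c. coeff lam D c - coeff lam D' c = lam c (D ! i) - lam c (D' ! i)"
    using coeff_diff_neighbouring[OF nb] by blast
  have T: "D ! i \<in> T" "D' ! i \<in> T"
    using i D by (auto simp: datasets_def)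
  have "(\<Sum>j=1..J. \<Sum>c\<in>Phi j. \<bar>coeff lam D c - coeff lam D' c\<bar>)
      \<le> (\<Sum>j=1..J. \<Sum>c\<in>Phi j. \<bar>lam c (D ! i)\<bar> + \<bar>lam c (D' ! i)\<bar>)"
    unfolding eq by (intro sum_mono abs_triangle_ineq4)
  also have "\<dots> = record_norm J lam (D ! i) + record_norm J lam (D' ! i)"
    by (simp add: record_norm_def sum.distrib)
  also have "\<dots> \<le> noise_bound J lam T"
    using cSUP_upper[OF T(1) bdd] cSUP_upper[OF T(2) bdd] by (simp add: noise_bound_def)
  finally show ?thesis .
qed

theorem theorem1:
  fixes \<epsilon> :: real and n J K :: nat
    and T :: "('d::finite) datum set" and Y :: "real set"
    and B :: "nat \<Rightarrow> 'd set"
    and lam :: "'d mon \<Rightarrow> 'd datum \<Rightarrow> real"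
    and prot :: "'d mon \<Rightarrow> 'd computation"
    and amin :: "(real ^ 'd \<Rightarrow> real) \<Rightarrow> real ^ 'd"
  assumes "0 < \<epsilon>"
    and "bounded Y"
    and "T \<subseteq> {x. \<forall>l. x $ l \<in> {-1..1}} \<times> Y"
    and "feature_blocks K B"
    and "coefficient_protocol J K B T n lam prot"
    and "bdd_above (record_norm J lam ` T)"
    and "0 < noise_bound J lam T"
    and "argmin_rule J amin"
  shows "differentially_private \<epsilon> (datasets T n)
           (functional_mechanism J B T lam prot amin \<epsilon>) borel"
proof -
  let ?M = "functional_mechanism J B T lam prot amin \<epsilon>"
  define I where "I = (monomials J :: 'd mon set)"
  define s where "s = noise_bound J lam T / \<epsilon>"
  define A where "A a = amin (poly_fun J a)" for a
  have s: "0 < s"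
    using assms by (simp add: s_def)
  have [measurable]: "A \<in> PiM I (\<lambda>_. borel) \<rightarrow>\<^sub>M borel"
    using assms(8) unfolding argmin_rule_def A_def[abs_def] I_def by blast
  have A_cong: "A a = A b" if "\<And>j c. j \<in> {1..J} \<Longrightarrow> c \<in> Phi j \<Longrightarrow> a c = b c" for a b
    using assms(8) that unfolding argmin_rule_def A_def by blast
  have in_I: "c \<in> I" if "j \<in> {1..J}" "c \<in> Phi j" for j and c :: "'d mon"
    using that by (auto simp: I_def monomials_def)
  \<comment> \<open>The protocol delivers exact coefficients, so from here on the mechanism is plain
    noise addition followed by \<open>A\<close>.\<close>
  have noisy: "noisy_coeffs J B prot D x = (\<lambda>c\<in>I. coeff lam D c + x c)"
    if "D \<in> datasets T n" for D x
    using assms(5) that by (auto simp: noisy_coeffs_def coefficient_protocol_def I_def fun_eq_iff)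
  \<comment> \<open>The probability of \<open>Z\<close> becomes an integral over the noise, the form
    to which the translation bound applies.\<close>
  have M: "emeasure (?M D) Z =
      (\<integral>\<^sup>+x. indicator Z (A (\<lambda>c\<in>I. coeff lam D c + x c)) \<partial>PiM I (\<lambda>_. laplace s))"
    if D: "D \<in> datasets T n" and Z [measurable]: "Z \<in> sets borel" for D Z
  proof -
    have [measurable]: "(\<lambda>x. A (\<lambda>c\<in>I. coeff lam D c + x c)) \<in> PiM I (\<lambda>_. laplace s) \<rightarrow>\<^sub>M borel"
      by measurable
    have "?M D = distr (PiM I (\<lambda>_. laplace s)) borel (\<lambda>x. A (\<lambda>c\<in>I. coeff lam D c + x c))"
      unfolding functional_mechanism_def noisy[OF D] I_def[symmetric] s_def[symmetric] A_def ..
    then have "emeasure (?M D) Z = (\<integral>\<^sup>+y. indicator Z y \<partial>distr (PiM I (\<lambda>_. laplace s)) borel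
        (\<lambda>x. A (\<lambda>c\<in>I. coeff lam D c + x c)))"
      by simp
    then show ?thesis
      by (simp add: nn_integral_distr del: nn_integral_indicator)
  qed
  show ?thesis
    unfolding differentially_private_def
  proof (intro ballI impI)
    fix D D' and Z :: "(real ^ 'd) set"
    assume D: "D \<in> datasets T n" and D': "D' \<in> datasets T n" and nb: "neighbouring D D'"
      and Z [measurable]: "Z \<in> sets borel"
    define u where "u c = (if c \<in> Phi 0 then 0 else coeff lam D c - coeff lam D' c)" for c
    define f where "f x = (indicator Z (A (\<lambda>c\<in>I. coeff lam D' c + x c)) :: ennreal)" for x
    have f [measurable]: "f \<in> borel_measurable (PiM I (\<lambda>_. borel))"
      unfolding f_def by measurable
    \<comment> \<open>Running on \<open>D\<close> with noise \<open>x\<close> gives the same output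
      as running on \<open>D'\<close> with noise \<open>u + x\<close>: the two coefficient vectors
      can differ only in the constant term, which \<open>A\<close> ignores.\<close>
    have translate: "indicator Z (A (\<lambda>c\<in>I. coeff lam D c + x c)) = f (\<lambda>c\<in>I. u c + x c)" for x
    proof -
      have "A (\<lambda>c\<in>I. coeff lam D c + x c) =
          A (\<lambda>c\<in>I. coeff lam D' c + (\<lambda>c\<in>I. u c + x c) c)"
        by (rule A_cong) (auto simp: in_I u_def Phi_def)
      then show ?thesis by (simp only: f_def)
    qed
    have "(\<Sum>c\<in>I. \<bar>u c\<bar>) = (\<Sum>j\<le>J. \<Sum>c\<in>Phi j. \<bar>u c\<bar>)"
      unfolding I_def by (rule sum_monomials)
    also have "\<dots> = (\<Sum>j=1..J. \<Sum>c\<in>Phi j. \<bar>u c\<bar>)"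
      by (rule sum.mono_neutral_right) (auto simp: u_def not_le)
    also have "\<dots> = (\<Sum>j=1..J. \<Sum>c\<in>Phi j. \<bar>coeff lam D c - coeff lam D' c\<bar>)"
      by (intro sum.cong refl) (auto simp: u_def Phi_def)
    also have "\<dots> \<le> noise_bound J lam T"
      by (rule coeff_sensitivity[OF assms(6) D D' nb])
    \<comment> \<open>The scale \<open>s\<close> is the sensitivity bound divided by \<epsilon>, so
      the exponent is at most \<epsilon>.\<close>
    finally have "(\<Sum>c\<in>I. \<bar>u c\<bar>) / s \<le> \<epsilon>"
      using assms(1,7) by (simp add: s_def field_simps)
    then have "ennreal (exp ((\<Sum>c\<in>I. \<bar>u c\<bar>) / s)) \<le> ennreal (exp \<epsilon>)"
      by (simp add: ennreal_leI)
    have "emeasure (?M D) Z = (\<integral>\<^sup>+x. f (\<lambda>c\<in>I. u c + x c) \<partial>PiM I (\<lambda>_. laplace s))"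
      unfolding M[OF D Z] translate ..
    also have "\<dots> \<le> ennreal (exp ((\<Sum>c\<in>I. \<bar>u c\<bar>) / s)) * (\<integral>\<^sup>+x. f x \<partial>PiM I (\<lambda>_. laplace s))"
      by (intro nn_integral_PiM_laplace_translate_le s f) (simp add: I_def finite_monomials)
    also have "\<dots> \<le> ennreal (exp \<epsilon>) * (\<integral>\<^sup>+x. f x \<partial>PiM I (\<lambda>_. laplace s))"
      by (intro mult_right_mono) (fact, simp)
    also have "\<dots> = ennreal (exp \<epsilon>) * emeasure (?M D') Z"
      unfolding M[OF D' Z] f_def ..
    finally have le: "emeasure (?M D) Z \<le> ennreal (exp \<epsilon>) * emeasure (?M D') Z" .
    \<comment> \<open>Both output distributions are finite measures, so the inequality passes from
      extended to real values.\<close>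
    interpret P: prob_space "?M D"
      by (rule prob_space_functional_mechanism[OF assms(1,7,8)])
    interpret P': prob_space "?M D'"
      by (rule prob_space_functional_mechanism[OF assms(1,7,8)])
    show "measure (?M D) Z \<le> exp \<epsilon> * measure (?M D') Z"
      using le by (simp add: P.emeasure_eq_measure P'.emeasure_eq_measure ennreal_mult'[symmetric])
  qed
qed

end
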